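(* Let $R$ be a $\mathbb{C}$-algebra which is a noetherian UFD, and for $a,b\in R$ put $A_{a,b}:=R[U,V]/(aU-bV-1)$. Let $r,s,r',s'\in R$ and suppose that each of the pairs $(a,b)=(r,s)$ and $(a,b)=(r',s')$ satisfies: the ideal $(a,b)$ has height $2$; $a,b$ share no common non-unit factor; $A_{a,b}$ is a UFD; $A_{a,b}^*=R^*$; $R$ is rigid and $ML(A_{a,b})=R$; and the restriction map $\operatorname{Aut}_{\mathbb{C}}(A_{a,b})\to\operatorname{Aut}_{\mathbb{C}}(R)$, $\sigma\mapsto\sigma|_R$ (well defined since such $\sigma$ satisfy $\sigma(R)=R$), is surjective. If $A_{r,s}\cong A_{r',s'}$ as $\mathbb{C}$-algebras, then there exists $\varphi\in\operatorname{Aut}_{\mathbb{C}}(R)$ such that $\varphi(r)R+\varphi(s)R=r'R+s'R$.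
   Context: A derivation $D$ of a ring $B$ is locally nilpotent if for every $b\in B$ there is $n$ with $D^n(b)=0$; $\operatorname{LND}(B)$ denotes the set of locally nilpotent $\mathbb{C}$-derivations of the $\mathbb{C}$-algebra $B$. The Makar-Limanov invariant $ML(B)$ is the intersection of the kernels of all $D\in\operatorname{LND}(B)$. $B$ is rigid if $\operatorname{LND}(B)=\{0\}$. $B^*$ denotes the unit group. *)

theory Defs
  imports "HOL-Algebra.Algebra" "HOL-Library.Extended_Nat"
begin

definition CC :: "complex ring" where
  "CC = \<lparr>carrier = UNIV, monoid.mult = (*), one = 1, ring.zero = 0, add = (+)\<rparr>"

text \<open>A C-algebra is a commutative ring A together with a ring homomorphism
  iA from CC to A (its structure map). Scalar multiplication by c is
  multiplication by iA c.\<close>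

definition is_C_algebra :: "('a, 'm) ring_scheme \<Rightarrow> (complex \<Rightarrow> 'a) \<Rightarrow> bool" where
  "is_C_algebra A iA \<longleftrightarrow> cring A \<and> iA \<in> ring_hom CC A"

definition C_alg_hom ::
  "('a, 'm) ring_scheme \<Rightarrow> (complex \<Rightarrow> 'a) \<Rightarrow> ('b, 'n) ring_scheme \<Rightarrow> (complex \<Rightarrow> 'b)
    \<Rightarrow> ('a \<Rightarrow> 'b) \<Rightarrow> bool" where
  "C_alg_hom A iA B iB f \<longleftrightarrow> f \<in> ring_hom A B \<and> (\<forall>c. f (iA c) = iB c)"

definition C_alg_iso ::
  "('a, 'm) ring_scheme \<Rightarrow> (complex \<Rightarrow> 'a) \<Rightarrow> ('b, 'n) ring_scheme \<Rightarrow> (complex \<Rightarrow> 'b)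
    \<Rightarrow> ('a \<Rightarrow> 'b) \<Rightarrow> bool" where
  "C_alg_iso A iA B iB f \<longleftrightarrow> C_alg_hom A iA B iB f \<and> bij_betw f (carrier A) (carrier B)"

definition C_alg_aut :: "('a, 'm) ring_scheme \<Rightarrow> (complex \<Rightarrow> 'a) \<Rightarrow> ('a \<Rightarrow> 'a) set" where
  "C_alg_aut A iA = {f. C_alg_iso A iA A iA f}"

definition C_derivation :: "('a, 'm) ring_scheme \<Rightarrow> (complex \<Rightarrow> 'a) \<Rightarrow> ('a \<Rightarrow> 'a) \<Rightarrow> bool" where
  "C_derivation A iA D \<longleftrightarrow>
     D \<in> carrier A \<rightarrow> carrier A \<and>
     (\<forall>x\<in>carrier A. \<forall>y\<in>carrier A. D (x \<oplus>\<^bsub>A\<^esub> y) = D x \<oplus>\<^bsub>A\<^esub> D y) \<and>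
     (\<forall>c. \<forall>x\<in>carrier A. D (iA c \<otimes>\<^bsub>A\<^esub> x) = iA c \<otimes>\<^bsub>A\<^esub> D x) \<and>
     (\<forall>x\<in>carrier A. \<forall>y\<in>carrier A.
        D (x \<otimes>\<^bsub>A\<^esub> y) = (x \<otimes>\<^bsub>A\<^esub> D y) \<oplus>\<^bsub>A\<^esub> (y \<otimes>\<^bsub>A\<^esub> D x))"

definition LND :: "('a, 'm) ring_scheme \<Rightarrow> (complex \<Rightarrow> 'a) \<Rightarrow> ('a \<Rightarrow> 'a) set" where
  "LND A iA = {D. C_derivation A iA D \<and> (\<forall>b\<in>carrier A. \<exists>n. (D ^^ n) b = \<zero>\<^bsub>A\<^esub>)}"

definition makar_limanov :: "('a, 'm) ring_scheme \<Rightarrow> (complex \<Rightarrow> 'a) \<Rightarrow> 'a set" where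
  "makar_limanov A iA = {x \<in> carrier A. \<forall>D\<in>LND A iA. D x = \<zero>\<^bsub>A\<^esub>}"

definition rigid :: "('a, 'm) ring_scheme \<Rightarrow> (complex \<Rightarrow> 'a) \<Rightarrow> bool" where
  "rigid A iA \<longleftrightarrow> (\<forall>D\<in>LND A iA. \<forall>x\<in>carrier A. D x = \<zero>\<^bsub>A\<^esub>)"

definition prime_chain :: "('a, 'm) ring_scheme \<Rightarrow> 'a set list \<Rightarrow> bool" where
  "prime_chain R Ps \<longleftrightarrow> Ps \<noteq> [] \<and> (\<forall>P\<in>set Ps. primeideal P R) \<and> sorted_wrt (\<subset>) Ps"

definition prime_height :: "('a, 'm) ring_scheme \<Rightarrow> 'a set \<Rightarrow> enat" where
  "prime_height R P = (SUP Ps \<in> {Ps. prime_chain R Ps \<and> last Ps = P}. enat (length Ps - 1))"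

definition ideal_height :: "('a, 'm) ring_scheme \<Rightarrow> 'a set \<Rightarrow> enat" where
  "ideal_height R I = (INF P \<in> {P. primeideal P R \<and> I \<subseteq> P}. prime_height R P)"

text \<open>R[U,V] is realized as (R[U])[V]; U is the variable of the inner
  polynomial ring, V that of the outer one.\<close>

definition polyUV :: "('a, 'm) ring_scheme \<Rightarrow> (nat \<Rightarrow> 'a, nat \<Rightarrow> nat \<Rightarrow> 'a) up_ring" where
  "polyUV R = UP (UP R)"

definition constUV :: "('a, 'm) ring_scheme \<Rightarrow> 'a \<Rightarrow> nat \<Rightarrow> nat \<Rightarrow> 'a" where
  "constUV R x = monom (polyUV R) (monom (UP R) x 0) 0"

definition varU :: "('a, 'm) ring_scheme \<Rightarrow> nat \<Rightarrow> nat \<Rightarrow> 'a" where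
  "varU R = monom (polyUV R) (monom (UP R) \<one>\<^bsub>R\<^esub> 1) 0"

definition varV :: "('a, 'm) ring_scheme \<Rightarrow> nat \<Rightarrow> nat \<Rightarrow> 'a" where
  "varV R = monom (polyUV R) \<one>\<^bsub>UP R\<^esub> 1"

definition rel_ideal :: "('a, 'm) ring_scheme \<Rightarrow> 'a \<Rightarrow> 'a \<Rightarrow> (nat \<Rightarrow> nat \<Rightarrow> 'a) set" where
  "rel_ideal R a b = Idl\<^bsub>polyUV R\<^esub>
     {(constUV R a \<otimes>\<^bsub>polyUV R\<^esub> varU R) \<ominus>\<^bsub>polyUV R\<^esub> (constUV R b \<otimes>\<^bsub>polyUV R\<^esub> varV R)
        \<ominus>\<^bsub>polyUV R\<^esub> \<one>\<^bsub>polyUV R\<^esub>}"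

definition Aab :: "('a, 'm) ring_scheme \<Rightarrow> 'a \<Rightarrow> 'a \<Rightarrow> (nat \<Rightarrow> nat \<Rightarrow> 'a) set ring" where
  "Aab R a b = polyUV R Quot rel_ideal R a b"

definition canA :: "('a, 'm) ring_scheme \<Rightarrow> 'a \<Rightarrow> 'a \<Rightarrow> 'a \<Rightarrow> (nat \<Rightarrow> nat \<Rightarrow> 'a) set" where
  "canA R a b x = rel_ideal R a b +>\<^bsub>polyUV R\<^esub> constUV R x"

definition iAab :: "('a, 'm) ring_scheme \<Rightarrow> (complex \<Rightarrow> 'a) \<Rightarrow> 'a \<Rightarrow> 'a \<Rightarrow> complex \<Rightarrow> (nat \<Rightarrow> nat \<Rightarrow> 'a) set" where
  "iAab R iR a b c = canA R a b (iR c)"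

definition good_pair :: "('a, 'm) ring_scheme \<Rightarrow> (complex \<Rightarrow> 'a) \<Rightarrow> 'a \<Rightarrow> 'a \<Rightarrow> bool" where
  "good_pair R iR a b \<longleftrightarrow>
     a \<in> carrier R \<and> b \<in> carrier R \<and>
     ideal_height R (Idl\<^bsub>R\<^esub> {a, b}) = 2 \<and>
     (\<forall>c\<in>carrier R. c divides\<^bsub>R\<^esub> a \<and> c divides\<^bsub>R\<^esub> b \<longrightarrow> c \<in> Units R) \<and>
     factorial_domain (Aab R a b) \<and>
     Units (Aab R a b) = canA R a b ` Units R \<and>
     rigid R iR \<and>
     makar_limanov (Aab R a b) (iAab R iR a b) = canA R a b ` carrier R \<and>
     (\<forall>\<phi>\<in>C_alg_aut R iR. \<exists>\<sigma>\<in>C_alg_aut (Aab R a b) (iAab R iR a b).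
        \<forall>x\<in>carrier R. \<sigma> (canA R a b x) = canA R a b (\<phi> x))"

end

theory Submission
  imports Defs
begin

text \<open>
  Write \<open>A = R[U,V]/(aU - bV - 1)\<close>. A locally nilpotent derivation \<open>E\<close> of \<open>A\<close> kills
  \<open>ML(A) = R\<close>, so \<open>a E(U) = b E(V)\<close>, and \<open>aU - bV = 1\<close> gives \<open>E(U) = b g\<close> and \<open>E(V) = a g\<close> with
  \<open>g = U E(V) - V E(U)\<close>. Hence \<open>g\<close> generates the ideal spanned by \<open>E(A)\<close>, and any two such
  derivations are proportional, so the kernel of a nonzero one is \<open>ML(A) = R\<close>. If \<open>E(x) = g c\<close> with
  \<open>c\<close> in \<open>R\<close>, then \<open>ax - cV\<close> and \<open>bx - cU\<close> lie in that kernel, and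
  \<open>b(ax - cV) - a(bx - cU) = c\<close>. So \<open>(a,b)\<close> consists of the \<open>c\<close> in \<open>ML(A)\<close> with \<open>g c\<close> in \<open>E(A)\<close>.
  As the units of \<open>A\<close> lie in \<open>R\<close>, the generator \<open>g\<close> may be replaced by any other one, and this
  description of \<open>(a,b)\<close> is preserved by isomorphisms.
\<close>

section \<open>Rings generated by a set\<close>

lemma (in ring_hom_ring) generate_ring_image:
  assumes "H \<subseteq> carrier R"
  shows "h ` generate_ring R H = generate_ring S (h ` H)"
proof
  show "h ` generate_ring R H \<subseteq> generate_ring S (h ` H)"
  proof (intro image_subsetI)
    fix x assume "x \<in> generate_ring R H"
    then show "h x \<in> generate_ring S (h ` H)"
      by (induction rule: generate_ring.induct)
        (use assms in \<open>auto intro: generate_ring.intros simp: R.generate_ring_in_carrier\<close>)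
  qed
  show "generate_ring S (h ` H) \<subseteq> h ` generate_ring R H"
    using assms by (intro S.generate_ring_min_subring1 img_is_subring R.generate_ring_is_subring)
      (auto intro: generate_ring.incl)
qed

lemma (in UP_cring) carrier_eq_generate_ring:
  "carrier P =
    generate_ring P ((\<lambda>c. up_ring.monom P c 0) ` carrier R \<union> {up_ring.monom P \<one> 1})"
    (is "_ = generate_ring P ?H")
proof
  have gens_subset: "?H \<subseteq> carrier P" by auto
  then show "generate_ring P ?H \<subseteq> carrier P" by (rule P.generate_ring_incl)
  have monom: "up_ring.monom P c n \<in> generate_ring P ?H" if c: "c \<in> carrier R" for c n
  proof (induction n)
    case 0
    show ?case using c by (auto intro: generate_ring.incl)
  next
    case (Suc n)
    have "up_ring.monom P c (Suc n) = up_ring.monom P c n \<otimes>\<^bsub>P\<^esub> up_ring.monom P \<one> 1"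
      using monom_mult[OF c R.one_closed, of n 1] c by simp
    moreover have "up_ring.monom P \<one> 1 \<in> generate_ring P ?H" by (auto intro: generate_ring.incl)
    ultimately show ?case using Suc by (auto intro: generate_ring.eng_mult)
  qed
  show "carrier P \<subseteq> generate_ring P ?H"
  proof
    fix p assume p: "p \<in> carrier P"
    have "(\<Oplus>\<^bsub>P\<^esub>k\<in>{..n}. up_ring.monom P (up_ring.coeff P p k) k) \<in> generate_ring P ?H" for n
      by (induction n) (use p monom in \<open>auto intro: generate_ring.eng_add simp: Pi_def\<close>)
    from this[of "deg R p"] show "p \<in> generate_ring P ?H" unfolding up_repr[OF p] .
  qed
qed

section \<open>Ideals\<close>

lemma (in cring) genideal_pair:
  assumes a: "a \<in> carrier R" and b: "b \<in> carrier R"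
  shows "Idl {a, b} = {x \<otimes> a \<oplus> y \<otimes> b | x y. x \<in> carrier R \<and> y \<in> carrier R}"
proof -
  have union_subset: "PIdl a \<union> PIdl b \<subseteq> carrier R" using a b by (auto simp: cgenideal_def)
  have "Idl {a, b} = Idl (PIdl a \<union> PIdl b)"
  proof
    show "Idl {a, b} \<subseteq> Idl (PIdl a \<union> PIdl b)"
      using genideal_self[OF union_subset] a b
      by (intro genideal_minimal genideal_ideal union_subset) (auto dest: cgenideal_self)
    have "PIdl a \<subseteq> Idl {a, b}" "PIdl b \<subseteq> Idl {a, b}"
      using a b genideal_self[of "{a, b}"]
      by (intro cgenideal_minimal genideal_ideal; simp)+
    then show "Idl (PIdl a \<union> PIdl b) \<subseteq> Idl {a, b}"
      using a b by (intro genideal_minimal genideal_ideal) auto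
  qed
  also have "\<dots> = PIdl a <+> PIdl b" by (intro union_genideal cgenideal_ideal a b)
  finally show ?thesis by (auto simp: set_add_def' cgenideal_def)
qed

lemma (in cring) coprime_proper_imp_nonzero:
  assumes a: "a \<in> carrier R"
    and coprime: "\<And>c. c \<in> carrier R \<Longrightarrow> c divides a \<Longrightarrow> c divides b \<Longrightarrow> c \<in> Units R"
    and proper: "Idl {a, b} \<noteq> carrier R"
  shows "b \<noteq> \<zero>"
proof
  assume b: "b = \<zero>"
  then have "a \<in> Units R" using coprime[OF a] divides_zero a by simp
  then have "\<one> = inv a \<otimes> a \<oplus> \<zero> \<otimes> b" "inv a \<in> carrier R" using b by simp_all
  then have "\<one> \<in> Idl {a, b}" using genideal_pair[OF a, of b] b by blast
  with proper show False
    using ideal.one_imp_carrier[OF genideal_ideal[of "{a, b}"]] a b by simp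
qed

lemma (in UP_domain) const_mem_cgenideal_imp_zero:
  assumes p: "p \<in> carrier P" "deg R p > 0" and c: "c \<in> carrier R"
    and mem: "up_ring.monom P c 0 \<in> PIdl\<^bsub>P\<^esub> p"
  shows "c = \<zero>"
proof (rule ccontr)
  assume nonzero: "c \<noteq> \<zero>"
  obtain q where q: "q \<in> carrier P" "up_ring.monom P c 0 = q \<otimes>\<^bsub>P\<^esub> p"
    using mem unfolding cgenideal_def by blast
  have "up_ring.coeff P (up_ring.monom P c 0) 0 \<noteq> \<zero>" using c nonzero by simp
  then have "q \<noteq> \<zero>\<^bsub>P\<^esub>" "p \<noteq> \<zero>\<^bsub>P\<^esub>" using q p by auto
  then have "deg R (up_ring.monom P c 0) = deg R q + deg R p"
    using q p(1) by (simp add: deg_mult)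
  with c p(2) show False by simp
qed

lemma ideal_height_carrier: "ideal_height R (carrier R) = \<infinity>"
proof -
  have "\<not> carrier R \<subseteq> P" if "primeideal P R" for P
    using primeideal.I_notcarr[OF that] ideal.Icarr[OF primeideal.axioms(1)[OF that]] by blast
  then have "{P. primeideal P R \<and> carrier R \<subseteq> P} = {}" by blast
  then show ?thesis
    unfolding ideal_height_def by (simp only: image_empty Inf_empty top_enat_def)
qed

section \<open>Derivations\<close>

lemma C_derivationD:
  assumes "C_derivation A iA D"
  shows C_derivation_closed: "x \<in> carrier A \<Longrightarrow> D x \<in> carrier A"
    and C_derivation_add: "x \<in> carrier A \<Longrightarrow> y \<in> carrier A \<Longrightarrow> D (x \<oplus>\<^bsub>A\<^esub> y) = D x \<oplus>\<^bsub>A\<^esub> D y"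
    and C_derivation_scalar: "x \<in> carrier A \<Longrightarrow> D (iA c \<otimes>\<^bsub>A\<^esub> x) = iA c \<otimes>\<^bsub>A\<^esub> D x"
    and C_derivation_mult: "x \<in> carrier A \<Longrightarrow> y \<in> carrier A \<Longrightarrow>
      D (x \<otimes>\<^bsub>A\<^esub> y) = (x \<otimes>\<^bsub>A\<^esub> D y) \<oplus>\<^bsub>A\<^esub> (y \<otimes>\<^bsub>A\<^esub> D x)"
  using assms unfolding C_derivation_def by auto

lemma LND_imp_C_derivation: "D \<in> LND A iA \<Longrightarrow> C_derivation A iA D"
  by (simp add: LND_def)

context cring
begin

lemma C_derivation_abelian_group_hom:
  assumes "C_derivation R iR D"
  shows "abelian_group_hom R R D"
  by (intro abelian_group_homI group_hom.intro group_hom_axioms.intro)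
    (use C_derivationD[OF assms] abelian_group_axioms a_group in \<open>auto simp: hom_def\<close>)

lemma C_derivation_minus:
  assumes D: "C_derivation R iR D" and "x \<in> carrier R" "y \<in> carrier R"
  shows "D (x \<ominus> y) = D x \<ominus> D y"
proof -
  interpret abelian_group_hom R R D by (rule C_derivation_abelian_group_hom[OF D])
  show ?thesis using assms(2,3) by (simp add: a_minus_def)
qed

lemma C_derivation_one:
  assumes D: "C_derivation R iR D"
  shows "D \<one> = \<zero>"
  using C_derivation_mult[OF D one_closed one_closed] C_derivation_closed[OF D one_closed] by simp

lemma C_derivation_smult:
  assumes D: "C_derivation R iR D" and iR: "\<And>c. iR c \<in> carrier R" and g: "g \<in> carrier R"
  shows "C_derivation R iR (\<lambda>x. g \<otimes> D x)"
  unfolding C_derivation_def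
proof (intro conjI allI ballI)
  note [simp] = C_derivation_closed[OF D] C_derivation_add[OF D] C_derivation_scalar[OF D]
  show "(\<lambda>x. g \<otimes> D x) \<in> carrier R \<rightarrow> carrier R" using g by simp
  fix x assume x: "x \<in> carrier R"
  then show "g \<otimes> D (iR c \<otimes> x) = iR c \<otimes> (g \<otimes> D x)" for c
    using g iR by (simp add: m_lcomm)
  fix y assume y: "y \<in> carrier R"
  have D_closed: "D x \<in> carrier R" "D y \<in> carrier R" using x y by auto
  show "g \<otimes> D (x \<oplus> y) = g \<otimes> D x \<oplus> g \<otimes> D y"
    using g x y by (simp add: r_distr)
  show "g \<otimes> D (x \<otimes> y) = x \<otimes> (g \<otimes> D y) \<oplus> y \<otimes> (g \<otimes> D x)"
    unfolding C_derivation_mult[OF D x y] using g x y D_closed by algebra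
qed

lemma C_derivation_eq_on_generate_ring:
  assumes D: "C_derivation R iR D" and D': "C_derivation R iR D'"
    and H: "H \<subseteq> carrier R" and eq: "\<And>x. x \<in> H \<Longrightarrow> D x = D' x"
    and x: "x \<in> generate_ring R H"
  shows "D x = D' x"
  using x
proof (induction rule: generate_ring.induct)
  case one
  show ?case by (simp add: C_derivation_one[OF D] C_derivation_one[OF D'])
next
  case (incl x)
  then show ?case by (rule eq)
next
  case (a_inv x)
  then show ?case using generate_ring_in_carrier[OF H]
    by (simp add: abelian_group_hom.hom_a_inv[OF C_derivation_abelian_group_hom[OF D]]
        abelian_group_hom.hom_a_inv[OF C_derivation_abelian_group_hom[OF D']])
next
  case (eng_add x y)
  then show ?case using generate_ring_in_carrier[OF H]
    by (simp add: C_derivation_add[OF D] C_derivation_add[OF D'])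
next
  case (eng_mult x y)
  then show ?case using generate_ring_in_carrier[OF H]
    by (simp add: C_derivation_mult[OF D] C_derivation_mult[OF D'])
qed

lemma C_derivation_image_generate_ring:
  assumes D: "C_derivation R iR D" and H: "H \<subseteq> carrier R"
  shows "D ` generate_ring R H \<subseteq> Idl (D ` H)"
proof (intro image_subsetI)
  have DH: "D ` H \<subseteq> carrier R" using C_derivation_closed[OF D] H by auto
  interpret ideal "Idl (D ` H)" R by (rule genideal_ideal[OF DH])
  fix x assume "x \<in> generate_ring R H"
  then show "D x \<in> Idl (D ` H)"
  proof (induction rule: generate_ring.induct)
    case one
    show ?case by (simp add: C_derivation_one[OF D])
  next
    case (incl x)
    then show ?case using genideal_self[OF DH] by blast
  next
    case (a_inv x)
    then show ?case using generate_ring_in_carrier[OF H]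
      by (simp add: abelian_group_hom.hom_a_inv[OF C_derivation_abelian_group_hom[OF D]])
  next
    case (eng_add x y)
    then show ?case using generate_ring_in_carrier[OF H] by (simp add: C_derivation_add[OF D])
  next
    case (eng_mult x y)
    then show ?case using generate_ring_in_carrier[OF H]
      by (simp add: C_derivation_mult[OF D] I_l_closed)
  qed
qed

end

text \<open>
  If \<open>g\<close> generates the ideal spanned by the image of \<open>D\<close>, these are the elements of the plinth ideal
  (image intersected with kernel) of \<open>D / g\<close>.
\<close>
definition reduced_plinth :: "('a, 'm) ring_scheme \<Rightarrow> (complex \<Rightarrow> 'a) \<Rightarrow> 'a set" where
  "reduced_plinth A iA = {c \<in> makar_limanov A iA. \<exists>D\<in>LND A iA. \<exists>g\<in>carrier A. g \<noteq> \<zero>\<^bsub>A\<^esub> \<and>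
     Idl\<^bsub>A\<^esub> {g} = Idl\<^bsub>A\<^esub> (D ` carrier A) \<and> g \<otimes>\<^bsub>A\<^esub> c \<in> D ` carrier A}"

section \<open>Invariance under isomorphisms\<close>

locale C_algebra_inverse_pair =
  f: ring_hom_cring A B f + h: ring_hom_cring B A h
  for A :: "('a, 'm) ring_scheme" and iA :: "complex \<Rightarrow> 'a"
    and B :: "('b, 'n) ring_scheme" and iB :: "complex \<Rightarrow> 'b" and f h +
  assumes iA_closed: "iA c \<in> carrier A"
    and f_scalar [simp]: "f (iA c) = iB c"
    and h_f [simp]: "x \<in> carrier A \<Longrightarrow> h (f x) = x"
    and f_h [simp]: "y \<in> carrier B \<Longrightarrow> f (h y) = y"

sublocale C_algebra_inverse_pair \<subseteq> inverse: C_algebra_inverse_pair B iB A iA h f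
proof
  show "iB c \<in> carrier B" for c using f.hom_closed[OF iA_closed[of c]] by simp
  show "h (iB c) = iA c" for c using h_f[OF iA_closed[of c]] by simp
qed simp_all

lemma (in C_algebra_inverse_pair) image_carrier: "f ` carrier A = carrier B"
  by (auto intro: rev_image_eqI[OF h.hom_closed])

lemma (in C_algebra_inverse_pair) image_genideal_subset:
  assumes "S \<subseteq> carrier A"
  shows "f ` (Idl\<^bsub>A\<^esub> S) \<subseteq> Idl\<^bsub>B\<^esub> (f ` S)"
proof -
  have fS: "f ` S \<subseteq> carrier B" using assms by auto
  have "Idl\<^bsub>A\<^esub> S \<subseteq> {x \<in> carrier A. f x \<in> Idl\<^bsub>B\<^esub> (f ` S)}"
    using f.S.genideal_self[OF fS] assms
    by (intro f.R.genideal_minimal f.ring.ideal_vimage f.S.genideal_ideal fS) auto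
  then show ?thesis by blast
qed

lemma (in C_algebra_inverse_pair) image_genideal:
  assumes S: "S \<subseteq> carrier A"
  shows "f ` (Idl\<^bsub>A\<^esub> S) = Idl\<^bsub>B\<^esub> (f ` S)"
proof
  show "f ` (Idl\<^bsub>A\<^esub> S) \<subseteq> Idl\<^bsub>B\<^esub> (f ` S)" by (rule image_genideal_subset[OF S])
  have fS: "f ` S \<subseteq> carrier B" using S by auto
  show "Idl\<^bsub>B\<^esub> (f ` S) \<subseteq> f ` (Idl\<^bsub>A\<^esub> S)"
  proof
    fix y assume y: "y \<in> Idl\<^bsub>B\<^esub> (f ` S)"
    have "h ` f ` S = S" using S by (force simp: image_image)
    then have "h y \<in> Idl\<^bsub>A\<^esub> S" using inverse.image_genideal_subset[OF fS] y by auto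
    moreover have "y \<in> carrier B" using ideal.Icarr[OF f.S.genideal_ideal[OF fS] y] .
    ultimately show "y \<in> f ` (Idl\<^bsub>A\<^esub> S)" by (metis f_h image_eqI)
  qed
qed

lemma (in C_algebra_inverse_pair) LND_conjugate:
  assumes D: "D \<in> LND A iA"
  shows "f \<circ> D \<circ> h \<in> LND B iB"
proof -
  have D': "C_derivation A iA D" by (rule LND_imp_C_derivation[OF D])
  note [simp] = C_derivation_closed[OF D'] C_derivation_add[OF D'] iA_closed inverse.iA_closed
  have "C_derivation B iB (f \<circ> D \<circ> h)"
    unfolding C_derivation_def
  proof (intro conjI allI ballI)
    fix c y assume "y \<in> carrier B"
    then show "(f \<circ> D \<circ> h) (iB c \<otimes>\<^bsub>B\<^esub> y) = iB c \<otimes>\<^bsub>B\<^esub> (f \<circ> D \<circ> h) y"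
      by (simp add: C_derivation_scalar[OF D'])
  qed (auto simp: C_derivation_mult[OF D'])
  moreover have "\<exists>n. ((f \<circ> D \<circ> h) ^^ n) y = \<zero>\<^bsub>B\<^esub>" if y: "y \<in> carrier B" for y
  proof -
    have "((f \<circ> D \<circ> h) ^^ n) y = f ((D ^^ n) (h y)) \<and> (D ^^ n) (h y) \<in> carrier A" for n
      using y by (induction n) auto
    moreover obtain n where "(D ^^ n) (h y) = \<zero>\<^bsub>A\<^esub>"
      using D h.hom_closed[OF y] unfolding LND_def by blast
    ultimately show ?thesis by (metis f.hom_zero)
  qed
  ultimately show ?thesis by (simp add: LND_def)
qed

lemma (in C_algebra_inverse_pair) makar_limanov_image_subset:
  "f ` makar_limanov A iA \<subseteq> makar_limanov B iB"
proof (intro image_subsetI)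
  fix x assume x: "x \<in> makar_limanov A iA"
  then have x_closed: "x \<in> carrier A" by (simp add: makar_limanov_def)
  have "D (f x) = \<zero>\<^bsub>B\<^esub>" if D: "D \<in> LND B iB" for D
  proof -
    have "h (D (f x)) = \<zero>\<^bsub>A\<^esub>"
      using inverse.LND_conjugate[OF D] x by (auto simp: makar_limanov_def)
    moreover have "D (f x) \<in> carrier B"
      using C_derivation_closed[OF LND_imp_C_derivation[OF D]] x_closed by simp
    ultimately show ?thesis by (metis f_h f.hom_zero)
  qed
  then show "f x \<in> makar_limanov B iB" using x_closed by (simp add: makar_limanov_def)
qed

lemma (in C_algebra_inverse_pair) makar_limanov_image:
  "f ` makar_limanov A iA = makar_limanov B iB"
proof
  show "makar_limanov B iB \<subseteq> f ` makar_limanov A iA"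
  proof
    fix y assume y: "y \<in> makar_limanov B iB"
    then have "y = f (h y)" by (simp add: makar_limanov_def)
    with y show "y \<in> f ` makar_limanov A iA" using inverse.makar_limanov_image_subset by blast
  qed
qed (rule makar_limanov_image_subset)

lemma (in C_algebra_inverse_pair) reduced_plinth_image_subset:
  "f ` reduced_plinth A iA \<subseteq> reduced_plinth B iB"
proof (intro image_subsetI)
  fix c assume "c \<in> reduced_plinth A iA"
  then obtain D g where c: "c \<in> makar_limanov A iA" and D: "D \<in> LND A iA"
    and g: "g \<in> carrier A" "g \<noteq> \<zero>\<^bsub>A\<^esub>" and gen: "Idl\<^bsub>A\<^esub> {g} = Idl\<^bsub>A\<^esub> (D ` carrier A)"
    and mem: "g \<otimes>\<^bsub>A\<^esub> c \<in> D ` carrier A"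
    unfolding reduced_plinth_def by blast
  let ?D = "f \<circ> D \<circ> h"
  have image: "?D ` carrier B = f ` D ` carrier A"
    by (simp only: image_comp[symmetric] inverse.image_carrier)
  have D_sub: "D ` carrier A \<subseteq> carrier A"
    using C_derivation_closed[OF LND_imp_C_derivation[OF D]] by auto
  have "f g \<noteq> \<zero>\<^bsub>B\<^esub>" using g by (metis h_f h.hom_zero)
  moreover have "Idl\<^bsub>B\<^esub> {f g} = Idl\<^bsub>B\<^esub> (?D ` carrier B)"
    unfolding image using image_genideal[of "{g}"] image_genideal[OF D_sub] gen g(1) by simp
  moreover have "f g \<otimes>\<^bsub>B\<^esub> f c \<in> ?D ` carrier B"
    unfolding image using imageI[OF mem, of f] g(1) c by (simp add: makar_limanov_def)
  moreover have "f c \<in> makar_limanov B iB" using makar_limanov_image_subset c by blast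
  ultimately show "f c \<in> reduced_plinth B iB"
    unfolding reduced_plinth_def using LND_conjugate[OF D] f.hom_closed[OF g(1)] by blast
qed

lemma (in C_algebra_inverse_pair) reduced_plinth_image:
  "f ` reduced_plinth A iA = reduced_plinth B iB"
proof
  show "reduced_plinth B iB \<subseteq> f ` reduced_plinth A iA"
  proof
    fix y assume y: "y \<in> reduced_plinth B iB"
    then have "y = f (h y)" by (simp add: reduced_plinth_def makar_limanov_def)
    with y show "y \<in> f ` reduced_plinth A iA" using inverse.reduced_plinth_image_subset by blast
  qed
qed (rule reduced_plinth_image_subset)

lemma C_alg_iso_iff: "C_alg_iso A iA B iB f \<longleftrightarrow> f \<in> ring_iso A B \<and> (\<forall>c. f (iA c) = iB c)"
  by (auto simp: C_alg_iso_def C_alg_hom_def ring_iso_def)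

lemma C_algebra_scalar_closed: "is_C_algebra A iA \<Longrightarrow> iA c \<in> carrier A"
  by (auto simp: is_C_algebra_def CC_def ring_hom_def)

lemma C_alg_iso_inverse_pair:
  assumes A: "is_C_algebra A iA" and B: "is_C_algebra B iB" and f: "C_alg_iso A iA B iB f"
  shows "C_algebra_inverse_pair A iA B iB f (inv_into (carrier A) f)"
proof -
  interpret A: cring A using A by (simp add: is_C_algebra_def)
  interpret B: cring B using B by (simp add: is_C_algebra_def)
  have iso: "f \<in> ring_iso A B" using f by (simp add: C_alg_iso_iff)
  then have bij: "bij_betw f (carrier A) (carrier B)" by (simp add: ring_iso_def)
  show ?thesis
  proof
    show "f \<in> ring_hom A B" "inv_into (carrier A) f \<in> ring_hom B A"
      using iso ring_iso_set_sym[OF A.ring_axioms iso] by (simp_all add: ring_iso_def)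
  qed (use f C_algebra_scalar_closed[OF A] bij in
      \<open>simp_all add: C_alg_iso_iff bij_betw_inv_into_left bij_betw_inv_into_right\<close>)
qed

lemma ring_iso_restrict_image:
  assumes "h \<in> ring_hom R B" "inj_on h (carrier R)"
  shows "h \<in> ring_iso R (B\<lparr>carrier := h ` carrier R\<rparr>)"
  using assms by (auto simp: ring_iso_def ring_hom_def bij_betw_def)

lemma C_alg_iso_of_equal_images:
  assumes R: "is_C_algebra R iR" and S: "is_C_algebra S iS"
    and h: "C_alg_hom R iR B iB h" "inj_on h (carrier R)"
    and k: "C_alg_hom S iS B iB k" "inj_on k (carrier S)"
    and image: "h ` carrier R = k ` carrier S"
  obtains \<phi> where "C_alg_iso R iR S iS \<phi>" "\<And>x. x \<in> carrier R \<Longrightarrow> k (\<phi> x) = h x"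
proof
  let ?\<phi> = "inv_into (carrier S) k \<circ> h"
  have "ring S" using S by (simp add: is_C_algebra_def cring.axioms)
  then have "inv_into (carrier S) k \<in> ring_iso (B\<lparr>carrier := h ` carrier R\<rparr>) S"
    unfolding image
    using k by (intro ring_iso_set_sym ring_iso_restrict_image) (simp_all add: C_alg_hom_def)
  moreover have "h \<in> ring_iso R (B\<lparr>carrier := h ` carrier R\<rparr>)"
    using h by (intro ring_iso_restrict_image) (simp_all add: C_alg_hom_def)
  moreover have "?\<phi> (iR c) = iS c" for c
    using h(1) k inv_into_f_f[OF k(2) C_algebra_scalar_closed[OF S]] by (simp add: C_alg_hom_def)
  ultimately show "C_alg_iso R iR S iS ?\<phi>" by (simp add: C_alg_iso_iff ring_iso_set_trans)
  show "k (?\<phi> x) = h x" if "x \<in> carrier R" for x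
    unfolding comp_apply by (rule f_inv_into_f) (use image that in blast)
qed

section \<open>Extensions generated by a unimodular relation\<close>

locale unimodular_extension =
  A?: domain A + base: ring_hom_cring R A i
  for A :: "('a, 'm) ring_scheme" (structure) and iA :: "complex \<Rightarrow> 'a"
    and R :: "('b, 'n) ring_scheme" and i +
  fixes iR :: "complex \<Rightarrow> 'b" and a b :: 'b and U V :: 'a
  assumes base_C_algebra: "is_C_algebra R iR"
    and base_scalar: "i (iR c) = iA c"
    and inj: "inj_on i (carrier R)"
    and a_closed: "a \<in> carrier R" and b_closed: "b \<in> carrier R"
    and U_closed: "U \<in> carrier A" and V_closed: "V \<in> carrier A"
    and unimodular: "i a \<otimes> U \<ominus> i b \<otimes> V = \<one>"
    and generated: "carrier A = generate_ring A (i ` carrier R \<union> {U, V})"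
    and makar_limanov_eq: "makar_limanov A iA = i ` carrier R"
    and Units_eq: "Units A = i ` Units R"
begin

lemma C_alg_hom_base: "C_alg_hom R iR A iA i"
  by (simp add: C_alg_hom_def base.homh base_scalar)

lemma C_algebra: "is_C_algebra A iA"
proof -
  have "iA = i \<circ> iR" by (simp add: fun_eq_iff base_scalar)
  then show ?thesis
    using base_C_algebra ring_hom_trans[of iR CC R i A] base.homh cring_axioms
    unfolding is_C_algebra_def by blast
qed

definition wronskian :: "('a \<Rightarrow> 'a) \<Rightarrow> 'a" where
  "wronskian E = U \<otimes> E V \<ominus> V \<otimes> E U"

lemma ia_closed: "i a \<in> carrier A" and ib_closed: "i b \<in> carrier A"
  using a_closed b_closed by auto

lemma LND_closed: "E \<in> LND A iA \<Longrightarrow> x \<in> carrier A \<Longrightarrow> E x \<in> carrier A"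
  by (rule C_derivation_closed[OF LND_imp_C_derivation])

lemma wronskian_closed: "E \<in> LND A iA \<Longrightarrow> wronskian E \<in> carrier A"
  by (simp add: wronskian_def LND_closed U_closed V_closed)

lemmas closed_simps = ia_closed ib_closed U_closed V_closed LND_closed wronskian_closed

lemma LND_base: "E \<in> LND A iA \<Longrightarrow> x \<in> carrier R \<Longrightarrow> E (i x) = \<zero>"
  using makar_limanov_eq unfolding makar_limanov_def by blast

lemma LND_base_mult:
  "E \<in> LND A iA \<Longrightarrow> x \<in> carrier R \<Longrightarrow> y \<in> carrier A \<Longrightarrow> E (i x \<otimes> y) = i x \<otimes> E y"
  using C_derivation_mult[OF LND_imp_C_derivation, of E A iA "i x" y]
  by (simp add: LND_base LND_closed)

lemma LND_U_V:
  assumes E: "E \<in> LND A iA"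
  shows LND_U: "E U = i b \<otimes> wronskian E" and LND_V: "E V = i a \<otimes> wronskian E"
proof -
  note closed = ia_closed ib_closed U_closed V_closed
    LND_closed[OF E U_closed] LND_closed[OF E V_closed]
  have "i a \<otimes> E U \<ominus> i b \<otimes> E V = E (i a \<otimes> U \<ominus> i b \<otimes> V)"
    using a_closed b_closed closed
    by (simp add: C_derivation_minus[OF LND_imp_C_derivation[OF E]] LND_base_mult[OF E])
  also have "\<dots> = \<zero>"
    unfolding unimodular by (rule C_derivation_one[OF LND_imp_C_derivation[OF E]])
  finally have relation: "i a \<otimes> E U \<ominus> i b \<otimes> E V = \<zero>" .
  have "i b \<otimes> wronskian E =
      (i a \<otimes> U \<ominus> i b \<otimes> V) \<otimes> E U \<ominus> U \<otimes> (i a \<otimes> E U \<ominus> i b \<otimes> E V)"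
    unfolding wronskian_def using closed by algebra
  then show "E U = i b \<otimes> wronskian E" unfolding relation unimodular using closed by algebra
  have "i a \<otimes> wronskian E =
      (i a \<otimes> U \<ominus> i b \<otimes> V) \<otimes> E V \<ominus> V \<otimes> (i a \<otimes> E U \<ominus> i b \<otimes> E V)"
    unfolding wronskian_def using closed by algebra
  then show "E V = i a \<otimes> wronskian E" unfolding relation unimodular using closed by algebra
qed

lemma genideal_wronskian:
  assumes E: "E \<in> LND A iA"
  shows "Idl {wronskian E} = Idl (E ` carrier A)"
proof
  let ?H = "i ` carrier R \<union> {U, V}"
  have gens_subset: "?H \<subseteq> carrier A" by (auto simp: closed_simps)
  have image: "E ` carrier A \<subseteq> carrier A" using LND_closed[OF E] by auto
  interpret W: ideal "Idl {wronskian E}" A by (rule genideal_ideal) (simp add: closed_simps E)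
  interpret I: ideal "Idl (E ` carrier A)" A by (rule genideal_ideal[OF image])
  have "wronskian E \<in> Idl {wronskian E}" by (rule genideal_self') (simp add: closed_simps E)
  then have "E ` ?H \<subseteq> Idl {wronskian E}"
    by (auto simp: LND_base[OF E] LND_U_V[OF E] closed_simps intro: W.I_l_closed)
  then have "Idl (E ` ?H) \<subseteq> Idl {wronskian E}" by (intro genideal_minimal W.ideal_axioms)
  then have "E ` carrier A \<subseteq> Idl {wronskian E}"
    using C_derivation_image_generate_ring[OF LND_imp_C_derivation[OF E] gens_subset]
    unfolding generated[symmetric] by blast
  then show "Idl (E ` carrier A) \<subseteq> Idl {wronskian E}"
    by (intro genideal_minimal W.ideal_axioms)
  have EU: "E U \<in> Idl (E ` carrier A)" and EV: "E V \<in> Idl (E ` carrier A)"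
    using genideal_self[OF image] U_closed V_closed by auto
  have "wronskian E \<in> Idl (E ` carrier A)"
    unfolding wronskian_def a_minus_def
    by (rule I.a_closed[OF I.I_l_closed[OF EV U_closed]
          I.a_inv_closed[OF I.I_l_closed[OF EU V_closed]]])
  then show "Idl {wronskian E} \<subseteq> Idl (E ` carrier A)"
    by (intro genideal_minimal I.ideal_axioms) simp
qed

lemma LND_proportional:
  assumes E: "E \<in> LND A iA" and F: "F \<in> LND A iA" and x: "x \<in> carrier A"
  shows "wronskian E \<otimes> F x = wronskian F \<otimes> E x"
proof (rule C_derivation_eq_on_generate_ring
    [where D = "\<lambda>x. wronskian E \<otimes> F x" and D' = "\<lambda>x. wronskian F \<otimes> E x"])
  show "C_derivation A iA (\<lambda>x. wronskian E \<otimes> F x)" "C_derivation A iA (\<lambda>x. wronskian F \<otimes> E x)"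
    using E F C_algebra_scalar_closed[OF C_algebra]
    by (simp_all add: C_derivation_smult LND_imp_C_derivation wronskian_closed)
  show "x \<in> generate_ring A (i ` carrier R \<union> {U, V})" using x generated by simp
  show "i ` carrier R \<union> {U, V} \<subseteq> carrier A" by (auto simp: closed_simps)
  fix x assume "x \<in> i ` carrier R \<union> {U, V}"
  then show "wronskian E \<otimes> F x = wronskian F \<otimes> E x"
    using E F by (auto simp: LND_base LND_U_V closed_simps m_ac)
qed

lemma LND_eq_zero_imp_mem_base:
  assumes E: "E \<in> LND A iA" "wronskian E \<noteq> \<zero>" and x: "x \<in> carrier A" "E x = \<zero>"
  shows "x \<in> i ` carrier R"
proof -
  have "F x = \<zero>" if F: "F \<in> LND A iA" for F
    using LND_proportional[OF E(1) F x(1)] x E F by (simp add: integral_iff closed_simps)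
  then show ?thesis using x(1) by (simp add: makar_limanov_eq[symmetric] makar_limanov_def)
qed

lemma syzygy_mem_base:
  assumes E: "E \<in> LND A iA" "wronskian E \<noteq> \<zero>" and cd: "c \<in> carrier R" "d \<in> carrier R"
    and x: "x \<in> carrier A" "E x = i c \<otimes> wronskian E"
    and y: "y \<in> carrier A" "E y = i d \<otimes> wronskian E"
  shows "i d \<otimes> x \<ominus> i c \<otimes> y \<in> i ` carrier R"
proof (rule LND_eq_zero_imp_mem_base[OF E])
  have closed: "i c \<in> carrier A" "i d \<in> carrier A" "wronskian E \<in> carrier A"
    using cd E by (auto simp: closed_simps)
  show "i d \<otimes> x \<ominus> i c \<otimes> y \<in> carrier A" using closed x y by simp
  have "E (i d \<otimes> x \<ominus> i c \<otimes> y) = i d \<otimes> (i c \<otimes> wronskian E) \<ominus> i c \<otimes> (i d \<otimes> wronskian E)"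
    using cd x y closed
    by (simp add: C_derivation_minus[OF LND_imp_C_derivation[OF E(1)]] LND_base_mult[OF E(1)])
  also have "\<dots> = \<zero>" using closed by algebra
  finally show "E (i d \<otimes> x \<ominus> i c \<otimes> y) = \<zero>" .
qed

lemma mem_genideal_imp_LND_image:
  assumes E: "E \<in> LND A iA" and c: "c \<in> Idl\<^bsub>R\<^esub> {a, b}"
  shows "wronskian E \<otimes> i c \<in> E ` carrier A"
proof -
  obtain x y where xy: "x \<in> carrier R" "y \<in> carrier R" "c = x \<otimes>\<^bsub>R\<^esub> a \<oplus>\<^bsub>R\<^esub> y \<otimes>\<^bsub>R\<^esub> b"
    using c base.R.genideal_pair[OF a_closed b_closed] by auto
  have closed: "i x \<in> carrier A" "i y \<in> carrier A" "wronskian E \<in> carrier A"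
    using xy E by (auto simp: closed_simps)
  have "E (i x \<otimes> V \<oplus> i y \<otimes> U) = i x \<otimes> E V \<oplus> i y \<otimes> E U"
    using xy closed E
    by (simp add: C_derivation_add[OF LND_imp_C_derivation[OF E]] LND_base_mult closed_simps)
  also have "\<dots> = wronskian E \<otimes> (i x \<otimes> i a \<oplus> i y \<otimes> i b)"
    unfolding LND_U_V[OF E] using closed ia_closed ib_closed by algebra
  also have "i x \<otimes> i a \<oplus> i y \<otimes> i b = i c" using xy a_closed b_closed by simp
  finally show ?thesis
    by (rule image_eqI[OF sym]) (use closed in \<open>simp add: closed_simps\<close>)
qed

lemma LND_image_imp_mem_genideal:
  assumes E: "E \<in> LND A iA" "wronskian E \<noteq> \<zero>" and c: "c \<in> carrier R"
    and mem: "wronskian E \<otimes> i c \<in> E ` carrier A"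
  shows "c \<in> Idl\<^bsub>R\<^esub> {a, b}"
proof -
  have ic_closed: "i c \<in> carrier A" using c by simp
  obtain x where x: "x \<in> carrier A" "E x = i c \<otimes> wronskian E"
    using mem ic_closed E by (auto simp: m_comm closed_simps)
  obtain y where y: "y \<in> carrier R" "i a \<otimes> x \<ominus> i c \<otimes> V = i y"
    using syzygy_mem_base[OF E c a_closed x V_closed LND_V[OF E(1)]] by blast
  obtain z where z: "z \<in> carrier R" "i b \<otimes> x \<ominus> i c \<otimes> U = i z"
    using syzygy_mem_base[OF E c b_closed x U_closed LND_U[OF E(1)]] by blast
  have "i ((\<ominus>\<^bsub>R\<^esub> z) \<otimes>\<^bsub>R\<^esub> a \<oplus>\<^bsub>R\<^esub> y \<otimes>\<^bsub>R\<^esub> b) = (\<ominus> i z) \<otimes> i a \<oplus> i y \<otimes> i b"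
    using y z a_closed b_closed by simp
  also have "\<dots> = i c \<otimes> (i a \<otimes> U \<ominus> i b \<otimes> V)"
    unfolding y(2)[symmetric] z(2)[symmetric]
    using ic_closed x(1) ia_closed ib_closed U_closed V_closed by algebra
  also have "\<dots> = i c" unfolding unimodular using ic_closed by simp
  finally have "(\<ominus>\<^bsub>R\<^esub> z) \<otimes>\<^bsub>R\<^esub> a \<oplus>\<^bsub>R\<^esub> y \<otimes>\<^bsub>R\<^esub> b = c"
    by (rule inj_onD[OF inj]) (use y(1) z(1) a_closed b_closed c in simp_all)
  then show ?thesis using base.R.genideal_pair[OF a_closed b_closed] y(1) z(1) by blast
qed

lemma ex_LND_wronskian_nonzero:
  assumes proper: "Idl\<^bsub>R\<^esub> {a, b} \<noteq> carrier R"
  shows "\<exists>E\<in>LND A iA. wronskian E \<noteq> \<zero>"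
proof (rule ccontr)
  assume "\<not> ?thesis"
  then have "E U = \<zero>" "E V = \<zero>" if "E \<in> LND A iA" for E
    using that by (simp_all add: LND_U_V closed_simps)
  then have "U \<in> i ` carrier R" "V \<in> i ` carrier R"
    using U_closed V_closed by (auto simp: makar_limanov_eq[symmetric] makar_limanov_def)
  then obtain u v where u: "u \<in> carrier R" "U = i u" and v: "v \<in> carrier R" "V = i v" by blast
  have "i (a \<otimes>\<^bsub>R\<^esub> u \<ominus>\<^bsub>R\<^esub> b \<otimes>\<^bsub>R\<^esub> v) = i \<one>\<^bsub>R\<^esub>"
    using unimodular u v a_closed b_closed by (simp add: a_minus_def base.R.minus_eq)
  then have "a \<otimes>\<^bsub>R\<^esub> u \<ominus>\<^bsub>R\<^esub> b \<otimes>\<^bsub>R\<^esub> v = \<one>\<^bsub>R\<^esub>"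
    by (rule inj_onD[OF inj]) (use u(1) v(1) a_closed b_closed in simp_all)
  then have "\<one>\<^bsub>R\<^esub> = u \<otimes>\<^bsub>R\<^esub> a \<oplus>\<^bsub>R\<^esub> (\<ominus>\<^bsub>R\<^esub> v) \<otimes>\<^bsub>R\<^esub> b"
    using u(1) v(1) a_closed b_closed base.R.one_closed by algebra
  then have "\<one>\<^bsub>R\<^esub> \<in> Idl\<^bsub>R\<^esub> {a, b}"
    using base.R.genideal_pair[OF a_closed b_closed] u(1) v(1) by blast
  then show False
    using proper ideal.one_imp_carrier[OF base.R.genideal_ideal[of "{a, b}"]] a_closed b_closed
    by simp
qed

lemma reduced_plinth_subset: "reduced_plinth A iA \<subseteq> i ` (Idl\<^bsub>R\<^esub> {a, b})"
proof
  interpret I: ideal "Idl\<^bsub>R\<^esub> {a, b}" R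
    by (rule base.R.genideal_ideal) (use a_closed b_closed in auto)
  fix y assume "y \<in> reduced_plinth A iA"
  then obtain c E g where c: "c \<in> carrier R" "y = i c" and E: "E \<in> LND A iA"
    and g: "g \<in> carrier A" "g \<noteq> \<zero>" "Idl {g} = Idl (E ` carrier A)"
    and mem: "g \<otimes> i c \<in> E ` carrier A"
    unfolding reduced_plinth_def makar_limanov_eq by blast
  have w_closed: "wronskian E \<in> carrier A" by (simp add: wronskian_closed E)
  have "g \<sim> wronskian E"
    using g(1,3) w_closed
    by (simp add: associated_iff_same_ideal cgenideal_eq_genideal genideal_wronskian E)
  then obtain u where u: "u \<in> Units R" "g = i u \<otimes> wronskian E"
    using g(1) w_closed by (auto simp: ring_associated_iff Units_eq)
  have u_closed: "u \<in> carrier R" using u(1) by blast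
  have "wronskian E \<noteq> \<zero>" using g(2) u u_closed by auto
  moreover have "wronskian E \<otimes> i (u \<otimes>\<^bsub>R\<^esub> c) \<in> E ` carrier A"
    using mem w_closed u_closed c by (simp add: u(2) m_ac)
  ultimately have "u \<otimes>\<^bsub>R\<^esub> c \<in> Idl\<^bsub>R\<^esub> {a, b}"
    using LND_image_imp_mem_genideal[OF E] u_closed c by simp
  then have "inv\<^bsub>R\<^esub> u \<otimes>\<^bsub>R\<^esub> (u \<otimes>\<^bsub>R\<^esub> c) \<in> Idl\<^bsub>R\<^esub> {a, b}"
    by (rule I.I_l_closed) (rule base.R.Units_inv_closed[OF u(1)])
  then have "c \<in> Idl\<^bsub>R\<^esub> {a, b}" using u(1) u_closed c by (simp add: base.R.m_assoc[symmetric])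
  then show "y \<in> i ` (Idl\<^bsub>R\<^esub> {a, b})" using c(2) by blast
qed

lemma reduced_plinth_eq:
  assumes "Idl\<^bsub>R\<^esub> {a, b} \<noteq> carrier R"
  shows "reduced_plinth A iA = i ` (Idl\<^bsub>R\<^esub> {a, b})"
proof (rule antisym[OF reduced_plinth_subset image_subsetI])
  fix c assume c: "c \<in> Idl\<^bsub>R\<^esub> {a, b}"
  have "c \<in> carrier R"
    using ideal.Icarr[OF base.R.genideal_ideal c] a_closed b_closed by simp
  then have "i c \<in> makar_limanov A iA" by (simp add: makar_limanov_eq)
  moreover obtain E where "E \<in> LND A iA" "wronskian E \<noteq> \<zero>"
    using ex_LND_wronskian_nonzero[OF assms] by blast
  ultimately show "i c \<in> reduced_plinth A iA"
    unfolding reduced_plinth_def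
    using mem_genideal_imp_LND_image[OF _ c] genideal_wronskian wronskian_closed by blast
qed

end

theorem unimodular_extension_iso:
  assumes A: "unimodular_extension A iA R i iR a b U V" "Idl\<^bsub>R\<^esub> {a, b} \<noteq> carrier R"
    and B: "unimodular_extension B iB S k iS c d U' V'" "Idl\<^bsub>S\<^esub> {c, d} \<noteq> carrier S"
    and f: "C_alg_iso A iA B iB f"
  shows "\<exists>\<phi>. C_alg_iso R iR S iS \<phi> \<and> Idl\<^bsub>S\<^esub> {\<phi> a, \<phi> b} = Idl\<^bsub>S\<^esub> {c, d}"
proof -
  interpret A: unimodular_extension A iA R i iR a b U V by fact
  interpret B: unimodular_extension B iB S k iS c d U' V' by fact
  interpret f: C_algebra_inverse_pair A iA B iB f "inv_into (carrier A) f"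
    by (rule C_alg_iso_inverse_pair[OF A.C_algebra B.C_algebra f])
  have "(f \<circ> i) ` carrier R = k ` carrier S"
    unfolding image_comp[symmetric] A.makar_limanov_eq[symmetric] B.makar_limanov_eq[symmetric]
    by (rule f.makar_limanov_image)
  moreover have "C_alg_hom R iR B iB (f \<circ> i)"
    using ring_hom_trans[OF A.base.homh f.f.homh] by (simp add: C_alg_hom_def A.base_scalar)
  moreover have "inj_on (f \<circ> i) (carrier R)"
    by (rule comp_inj_on[OF A.inj inj_on_inverseI]) (auto intro: f.h_f)
  ultimately obtain \<phi> where \<phi>: "C_alg_iso R iR S iS \<phi>"
    and k_\<phi>: "\<And>x. x \<in> carrier R \<Longrightarrow> k (\<phi> x) = (f \<circ> i) x"
    using C_alg_iso_of_equal_images[OF A.base_C_algebra B.base_C_algebra _ _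
        B.C_alg_hom_base B.inj] by metis
  interpret \<phi>: C_algebra_inverse_pair R iR S iS \<phi> "inv_into (carrier R) \<phi>"
    by (rule C_alg_iso_inverse_pair[OF A.base_C_algebra B.base_C_algebra \<phi>])
  have ab: "{a, b} \<subseteq> carrier R" and cd: "{c, d} \<subseteq> carrier S"
    using A.a_closed A.b_closed B.a_closed B.b_closed by auto
  have ideals: "Idl\<^bsub>R\<^esub> {a, b} \<subseteq> carrier R" "Idl\<^bsub>S\<^esub> {c, d} \<subseteq> carrier S"
    using ideal.Icarr[OF A.base.R.genideal_ideal[OF ab]]
      ideal.Icarr[OF B.base.R.genideal_ideal[OF cd]] by blast+
  have "k ` \<phi> ` (Idl\<^bsub>R\<^esub> {a, b}) = f ` i ` (Idl\<^bsub>R\<^esub> {a, b})"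
    unfolding image_image using ideals(1) k_\<phi> by (intro image_cong) auto
  also have "\<dots> = f ` reduced_plinth A iA" by (simp only: A.reduced_plinth_eq[OF A(2)])
  also have "\<dots> = k ` (Idl\<^bsub>S\<^esub> {c, d})"
    unfolding f.reduced_plinth_image by (rule B.reduced_plinth_eq[OF B(2)])
  finally have "\<phi> ` (Idl\<^bsub>R\<^esub> {a, b}) = Idl\<^bsub>S\<^esub> {c, d}"
    by (rule iffD1[OF inj_on_image_eq_iff[OF B.inj], rotated 2]) (use ideals in auto)
  then have "Idl\<^bsub>S\<^esub> {\<phi> a, \<phi> b} = Idl\<^bsub>S\<^esub> {c, d}"
    using \<phi>.image_genideal[OF ab] by (simp only: image_insert image_empty)
  with \<phi> show ?thesis by blast
qed

section \<open>The algebra \<open>R[U,V]/(aU - bV - 1)\<close>\<close>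

locale unimodular_quotient = cring R
  for R :: "('a, 'm) ring_scheme" (structure) +
  fixes a b :: 'a
  assumes a_closed: "a \<in> carrier R" and b_closed: "b \<in> carrier R"
begin

sublocale inner: UP_cring R "UP R"
  by unfold_locales

sublocale outer: UP_cring "UP R" "polyUV R"
  by unfold_locales (simp add: polyUV_def)

sublocale const: ring_hom_cring R "polyUV R" "constUV R"
proof
  show "constUV R \<in> ring_hom R (polyUV R)"
    using ring_hom_trans[OF inner.const_ring_hom outer.const_ring_hom]
    by (simp add: constUV_def[abs_def] comp_def)
qed

lemma varU_closed: "varU R \<in> carrier (polyUV R)"
  by (simp add: varU_def)

lemma varV_closed: "varV R \<in> carrier (polyUV R)"
  by (simp add: varV_def)

definition relator :: "nat \<Rightarrow> nat \<Rightarrow> 'a" where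
  "relator = (constUV R a \<otimes>\<^bsub>polyUV R\<^esub> varU R) \<ominus>\<^bsub>polyUV R\<^esub>
     (constUV R b \<otimes>\<^bsub>polyUV R\<^esub> varV R) \<ominus>\<^bsub>polyUV R\<^esub> \<one>\<^bsub>polyUV R\<^esub>"

lemma relator_closed: "relator \<in> carrier (polyUV R)"
  using a_closed b_closed varU_closed varV_closed by (simp add: relator_def)

lemma rel_ideal_eq_cgenideal: "rel_ideal R a b = PIdl\<^bsub>polyUV R\<^esub> relator"
  using outer.P.cgenideal_eq_genideal[OF relator_closed] by (simp add: rel_ideal_def relator_def)

sublocale I: ideal "rel_ideal R a b" "polyUV R"
  unfolding rel_ideal_eq_cgenideal by (rule outer.P.cgenideal_ideal[OF relator_closed])

abbreviation proj :: "(nat \<Rightarrow> nat \<Rightarrow> 'a) \<Rightarrow> (nat \<Rightarrow> nat \<Rightarrow> 'a) set" where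
  "proj \<equiv> (+>\<^bsub>polyUV R\<^esub>) (rel_ideal R a b)"

lemma carrier_Aab: "carrier (Aab R a b) = proj ` carrier (polyUV R)"
  unfolding Aab_def FactRing_def A_RCOSETS_def' by auto

lemma proj_eq_zero_iff:
  assumes "p \<in> carrier (polyUV R)"
  shows "proj p = \<zero>\<^bsub>Aab R a b\<^esub> \<longleftrightarrow> p \<in> PIdl\<^bsub>polyUV R\<^esub> relator"
proof -
  have "\<zero>\<^bsub>Aab R a b\<^esub> = rel_ideal R a b" by (simp add: Aab_def FactRing_def)
  then show ?thesis
    unfolding rel_ideal_eq_cgenideal[symmetric]
    using I.a_rcos_const I.rcos_const_imp_mem[OF assms] by auto
qed

sublocale proj: ring_hom_cring "polyUV R" "Aab R a b" proj
  unfolding Aab_def by (rule I.rcos_ring_hom_cring[OF outer.P.cring_axioms])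

sublocale can: ring_hom_cring R "Aab R a b" "canA R a b"
proof
  show "canA R a b \<in> ring_hom R (Aab R a b)"
    using ring_hom_trans[OF const.homh proj.homh] by (simp add: canA_def[abs_def] comp_def)
qed

lemma proj_unimodular:
  "canA R a b a \<otimes>\<^bsub>Aab R a b\<^esub> proj (varU R) \<ominus>\<^bsub>Aab R a b\<^esub> canA R a b b \<otimes>\<^bsub>Aab R a b\<^esub> proj (varV R)
    = \<one>\<^bsub>Aab R a b\<^esub>"
proof -
  note closed = const.hom_closed[OF a_closed] const.hom_closed[OF b_closed] varU_closed varV_closed
    relator_closed outer.P.one_closed
  have "constUV R a \<otimes>\<^bsub>polyUV R\<^esub> varU R \<ominus>\<^bsub>polyUV R\<^esub> constUV R b \<otimes>\<^bsub>polyUV R\<^esub> varV R =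
      relator \<oplus>\<^bsub>polyUV R\<^esub> \<one>\<^bsub>polyUV R\<^esub>"
    unfolding relator_def using closed by algebra
  moreover have "proj relator = \<zero>\<^bsub>Aab R a b\<^esub>"
    using proj_eq_zero_iff[OF relator_closed] outer.P.cgenideal_self[OF relator_closed] by blast
  ultimately have "proj (constUV R a \<otimes>\<^bsub>polyUV R\<^esub> varU R \<ominus>\<^bsub>polyUV R\<^esub>
      constUV R b \<otimes>\<^bsub>polyUV R\<^esub> varV R) = \<one>\<^bsub>Aab R a b\<^esub>"
    using closed by simp
  then show ?thesis using closed by (simp add: canA_def a_minus_def)
qed

lemma polyUV_eq_generate_ring:
  "carrier (polyUV R) = generate_ring (polyUV R) (constUV R ` carrier R \<union> {varU R, varV R})"
    (is "_ = generate_ring _ ?H")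
proof
  have gens_subset: "?H \<subseteq> carrier (polyUV R)" by (auto simp: varU_closed varV_closed)
  then show "generate_ring (polyUV R) ?H \<subseteq> carrier (polyUV R)"
    by (rule outer.P.generate_ring_incl)
  interpret const_map: ring_hom_ring "UP R" "polyUV R" "\<lambda>p. up_ring.monom (polyUV R) p 0"
    by (rule ring_hom_ringI2) (rule inner.P.ring_axioms outer.P.ring_axioms outer.const_ring_hom)+
  let ?K = "(\<lambda>c. up_ring.monom (UP R) c 0) ` carrier R \<union> {up_ring.monom (UP R) \<one> 1}"
  have "(\<lambda>p. up_ring.monom (polyUV R) p 0) ` carrier (UP R) =
      generate_ring (polyUV R) ((\<lambda>p. up_ring.monom (polyUV R) p 0) ` ?K)"
    by (subst inner.carrier_eq_generate_ring, rule const_map.generate_ring_image) auto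
  also have "(\<lambda>p. up_ring.monom (polyUV R) p 0) ` ?K = constUV R ` carrier R \<union> {varU R}"
    by (simp add: image_Un image_image constUV_def varU_def)
  also have "generate_ring (polyUV R) \<dots> \<subseteq> generate_ring (polyUV R) ?H"
    by (rule outer.P.mono_generate_ring[OF _ gens_subset]) auto
  finally have "(\<lambda>p. up_ring.monom (polyUV R) p 0) ` carrier (UP R) \<union> {varV R}
      \<subseteq> generate_ring (polyUV R) ?H"
    by (auto intro: generate_ring.incl)
  then show "carrier (polyUV R) \<subseteq> generate_ring (polyUV R) ?H"
    unfolding outer.carrier_eq_generate_ring varV_def[symmetric]
    using gens_subset varV_closed
    by (intro outer.P.generate_ring_min_subring1 outer.P.generate_ring_is_subring) auto
qed

lemma Aab_eq_generate_ring:
  "carrier (Aab R a b) =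
    generate_ring (Aab R a b) (canA R a b ` carrier R \<union> {proj (varU R), proj (varV R)})"
proof -
  have "carrier (Aab R a b) =
      generate_ring (Aab R a b) (proj ` (constUV R ` carrier R \<union> {varU R, varV R}))"
    by (subst carrier_Aab, subst polyUV_eq_generate_ring, rule proj.ring.generate_ring_image)
      (auto simp: varU_closed varV_closed)
  then show ?thesis by (simp add: image_Un image_image canA_def)
qed

lemma coeff_relator: "up_ring.coeff (polyUV R) relator 1 = \<ominus>\<^bsub>UP R\<^esub> up_ring.monom (UP R) b 0"
proof -
  have "constUV R a \<otimes>\<^bsub>polyUV R\<^esub> varU R = up_ring.monom (polyUV R)
      (up_ring.monom (UP R) a 0 \<otimes>\<^bsub>UP R\<^esub> up_ring.monom (UP R) \<one> 1) 0"
    using a_closed outer.monom_mult[of "up_ring.monom (UP R) a 0" "up_ring.monom (UP R) \<one> 1" 0 0]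
    by (simp add: constUV_def varU_def)
  moreover have "constUV R b \<otimes>\<^bsub>polyUV R\<^esub> varV R =
      up_ring.monom (polyUV R) (up_ring.monom (UP R) b 0) 1"
    using b_closed outer.monom_mult[of "up_ring.monom (UP R) b 0" "\<one>\<^bsub>UP R\<^esub>" 0 1]
    by (simp add: constUV_def varV_def)
  ultimately show ?thesis
    using a_closed b_closed by (simp add: relator_def a_minus_def del: outer.monom_mult)
qed

lemma canA_inj:
  assumes "domain R" and b: "b \<noteq> \<zero>"
  shows "inj_on (canA R a b) (carrier R)"
proof -
  interpret D: domain R by fact
  interpret inner: UP_domain R "UP R" by unfold_locales
  interpret outer: UP_domain "UP R" "polyUV R" by unfold_locales
  have "up_ring.monom (UP R) b 0 \<noteq> \<zero>\<^bsub>UP R\<^esub>"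
    using inj_onD[OF inner.monom_inj[of 0], of b \<zero>] b_closed b by auto
  then have "up_ring.coeff (polyUV R) relator 1 \<noteq> \<zero>\<^bsub>UP R\<^esub>"
    unfolding coeff_relator
    using b_closed inner.P.add.inv_eq_1_iff[of "up_ring.monom (UP R) b 0"] by (simp add: a_inv_def)
  then have deg: "0 < deg (UP R) relator"
    using outer.deg_belowI[OF _ relator_closed, of 1] by simp
  have "x = \<zero>" if x: "x \<in> carrier R" "canA R a b x = \<zero>\<^bsub>Aab R a b\<^esub>" for x
  proof -
    have "constUV R x \<in> PIdl\<^bsub>polyUV R\<^esub> relator"
      using x proj_eq_zero_iff[OF const.hom_closed[OF x(1)]] unfolding canA_def by blast
    then have "up_ring.monom (UP R) x 0 = \<zero>\<^bsub>UP R\<^esub>"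
      using x(1) deg by (intro outer.const_mem_cgenideal_imp_zero[OF relator_closed])
        (simp_all add: constUV_def)
    then show ?thesis using inj_onD[OF inner.monom_inj[of 0], of x \<zero>] x(1) by simp
  qed
  then have "a_kernel R (Aab R a b) (canA R a b) = {\<zero>}"
    unfolding a_kernel_def' using can.hom_zero by blast
  then show ?thesis by (rule can.ring.trivial_ker_imp_inj)
qed

end

section \<open>Good pairs\<close>

lemma good_pair_unimodular_quotient:
  assumes "cring R" "good_pair R iR a b"
  shows "unimodular_quotient R a b"
  using assms by (simp add: good_pair_def unimodular_quotient_def unimodular_quotient_axioms_def)

lemma good_pair_genideal_proper:
  assumes "good_pair R iR a b"
  shows "Idl\<^bsub>R\<^esub> {a, b} \<noteq> carrier R"
proof
  assume "Idl\<^bsub>R\<^esub> {a, b} = carrier R"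
  with assms ideal_height_carrier[of R] show False
    by (simp add: good_pair_def)
qed

lemma good_pair_unimodular_extension:
  assumes R: "domain R" "is_C_algebra R iR" and good: "good_pair R iR a b"
  shows "unimodular_extension (Aab R a b) (iAab R iR a b) R (canA R a b) iR a b
    (rel_ideal R a b +>\<^bsub>polyUV R\<^esub> varU R) (rel_ideal R a b +>\<^bsub>polyUV R\<^esub> varV R)"
proof -
  interpret domain R by fact
  interpret unimodular_quotient R a b
    by (rule good_pair_unimodular_quotient[OF cring_axioms good])
  have "b \<noteq> \<zero>\<^bsub>R\<^esub>"
    using good by (intro coprime_proper_imp_nonzero[OF a_closed] good_pair_genideal_proper[OF good])
      (auto simp: good_pair_def)
  then have inj: "inj_on (canA R a b) (carrier R)" by (rule canA_inj[OF R(1)])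
  have "domain (Aab R a b)" using good by (simp add: good_pair_def factorial_domain_def)
  then interpret A: domain "Aab R a b" .
  show ?thesis
  proof
    show "is_C_algebra R iR" "inj_on (canA R a b) (carrier R)" by fact+
    show "a \<in> carrier R" "b \<in> carrier R" by (rule a_closed b_closed)+
    show "proj (varU R) \<in> carrier (Aab R a b)" "proj (varV R) \<in> carrier (Aab R a b)"
      by (simp_all only: proj.hom_closed varU_closed varV_closed)
    show "makar_limanov (Aab R a b) (iAab R iR a b) = canA R a b ` carrier R"
      "Units (Aab R a b) = canA R a b ` Units R"
      using good by (simp_all only: good_pair_def)
  qed (rule iAab_def[symmetric] proj_unimodular Aab_eq_generate_ring)+
qed

theorem mainTheorem7:
  fixes R :: "'a ring" and iR :: "complex \<Rightarrow> 'a" and r s r' s' :: 'a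
  assumes "is_C_algebra R iR"
    and "noetherian_domain R"
    and "factorial_domain R"
    and "good_pair R iR r s"
    and "good_pair R iR r' s'"
    and "\<exists>f. C_alg_iso (Aab R r s) (iAab R iR r s) (Aab R r' s') (iAab R iR r' s') f"
  shows "\<exists>\<phi>\<in>C_alg_aut R iR. Idl\<^bsub>R\<^esub> {\<phi> r, \<phi> s} = Idl\<^bsub>R\<^esub> {r', s'}"
proof -
  have R: "domain R" using assms(3) by (simp add: factorial_domain_def)
  obtain f where "C_alg_iso (Aab R r s) (iAab R iR r s) (Aab R r' s') (iAab R iR r' s') f"
    using assms(6) by blast
  then have "\<exists>\<phi>. C_alg_iso R iR R iR \<phi> \<and> Idl\<^bsub>R\<^esub> {\<phi> r, \<phi> s} = Idl\<^bsub>R\<^esub> {r', s'}"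
    by (rule unimodular_extension_iso[
          OF good_pair_unimodular_extension[OF R assms(1,4)] good_pair_genideal_proper[OF assms(4)]
            good_pair_unimodular_extension[OF R assms(1,5)] good_pair_genideal_proper[OF assms(5)]])
  then show ?thesis by (auto simp: C_alg_aut_def)
qed

end
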